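(* Let $p,\theta\in\mathbb{C}$. Then for all $z\in\mathbb{C}$ with $|z|^2<\frac{1}{|\theta|}$ and $\arg(1+\theta z^2)\in(-\pi,\pi)$, $$(1+\theta z^2)^p\,\mathrm{Erf}(z)=\sum_{n=0}^{\infty}a_n z^{2n+1},\qquad a_n=\frac{(-1)^n u_n}{\sqrt{\pi}},$$ where $u_0=1$, $u_1=\frac13-\theta p$, $u_2=\frac12\left(\frac15-\frac{2\theta p}{3}+\theta^2(p-1)p\right)$ and, for all $n\ge2$, $$u_{n+1}=\beta_0(n)u_n+\beta_1(n)u_{n-1}+\beta_2(n)u_{n-2},$$ with \begin{align*} \beta_0(n)&=\frac{1+2\theta n(1+2n)-\theta p(3+4n)+2n}{(n+1)(3+2n)},\\ \beta_1(n)&=\frac{\theta\left(-1-\theta(n-p-1)\left(\frac32+n-p-2\right)-2n+p+2\right)}{(n+1)\left(\frac32+n\right)},\\ \beta_2(n)&=\frac{\theta^2(2n-2p-3)}{(n+1)(3+2n)}. \end{align*}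
   Context: The error function is normalized here as $\mathrm{Erf}(z)=\frac{z}{\sqrt\pi}M\left(\frac12;\frac32;-z^2\right)=\frac{1}{\sqrt{\pi}}\int_0^z e^{-t^2}dt$, where $M(a;c;z)=\sum_{n=0}^\infty\frac{(a)_n}{(c)_n}\frac{z^n}{n!}$ is the confluent hypergeometric function and $(a)_n=a(a+1)\cdots(a+n-1)$, $(a)_0=1$. Powers are principal branches. When $\theta=0$, $1/|\theta|$ is read as $+\infty$. *)

theory Defs
  imports "HOL-Analysis.Analysis"
begin

definition kummer_M :: "complex \<Rightarrow> complex \<Rightarrow> complex \<Rightarrow> complex" where
  "kummer_M a c z = (\<Sum>n. pochhammer a n / pochhammer c n * (z ^ n / fact n))"

(* This is 1 / sqrt pi times the integral of exp (- t^2) from 0 to z, i.e. half of the usual erf. *)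
definition Erf :: "complex \<Rightarrow> complex" where
  "Erf z = z / of_real (sqrt pi) * kummer_M (1/2) (3/2) (- (z ^ 2))"

definition beta0 :: "complex \<Rightarrow> complex \<Rightarrow> nat \<Rightarrow> complex" where
  "beta0 \<theta> p k = (let n = of_nat k in
     (1 + 2 * \<theta> * n * (1 + 2 * n) - \<theta> * p * (3 + 4 * n) + 2 * n) / ((n + 1) * (3 + 2 * n)))"

definition beta1 :: "complex \<Rightarrow> complex \<Rightarrow> nat \<Rightarrow> complex" where
  "beta1 \<theta> p k = (let n = of_nat k in
     \<theta> * (- 1 - \<theta> * (n - p - 1) * (3/2 + n - p - 2) - 2 * n + p + 2) / ((n + 1) * (3/2 + n)))"

definition beta2 :: "complex \<Rightarrow> complex \<Rightarrow> nat \<Rightarrow> complex" where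
  "beta2 \<theta> p k = (let n = of_nat k in
     \<theta> ^ 2 * (2 * n - 2 * p - 3) / ((n + 1) * (3 + 2 * n)))"

(* The last equation is the recurrence at n = m + 2; u_coeff_rec restates it for n >= 2. *)
fun u_coeff :: "complex \<Rightarrow> complex \<Rightarrow> nat \<Rightarrow> complex" where
  "u_coeff \<theta> p 0 = 1"
| "u_coeff \<theta> p (Suc 0) = 1/3 - \<theta> * p"
| "u_coeff \<theta> p (Suc (Suc 0)) = 1/2 * (1/5 - 2 * \<theta> * p / 3 + \<theta> ^ 2 * (p - 1) * p)"
| "u_coeff \<theta> p (Suc (Suc (Suc m))) =
     beta0 \<theta> p (Suc (Suc m)) * u_coeff \<theta> p (Suc (Suc m))
     + beta1 \<theta> p (Suc (Suc m)) * u_coeff \<theta> p (Suc m)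
     + beta2 \<theta> p (Suc (Suc m)) * u_coeff \<theta> p m"

lemma u_coeff_rec:
  assumes "n \<ge> 2"
  shows "u_coeff \<theta> p (n + 1) =
    beta0 \<theta> p n * u_coeff \<theta> p n + beta1 \<theta> p n * u_coeff \<theta> p (n - 1) + beta2 \<theta> p n * u_coeff \<theta> p (n - 2)"
proof -
  obtain m where "n = Suc (Suc m)"
    using assms by (metis add_2_eq_Suc le_Suc_ex)
  then show ?thesis by simp
qed

definition a_coeff :: "complex \<Rightarrow> complex \<Rightarrow> nat \<Rightarrow> complex" where
  "a_coeff \<theta> p n = (- 1) ^ n * u_coeff \<theta> p n / of_real (sqrt pi)"

end

theory Submission
  imports Defs
begin

text \<open>
  Put \<open>w = - z\<^sup>2\<close>. Up to the factor \<open>z / sqrt pi\<close>, the function to be expanded is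
  \<open>(1 - \<theta> w)\<^sup>p M(1/2; 3/2; w)\<close>, and the claim is that its power series in \<open>w\<close> has the
  coefficients \<open>u\<^sub>n\<close>.

  As formal power series, \<open>B = (1 - \<theta> X)\<^sup>p\<close> solves \<open>(1 - \<theta> X) B' = - p \<theta> B\<close> and \<open>M\<close> solves Kummer's
  equation \<open>X M'' + (c - X) M' - a M = 0\<close>. Substituting \<open>M = G / B\<close> and clearing denominators with
  \<open>(1 - \<theta> X)\<^sup>2\<close> gives a second-order equation for \<open>G = B M\<close> whose coefficients are polynomials of
  degree at most 3 (\<open>binomial_times_kummer_ode\<close>). Comparing coefficients therefore links four
  consecutive coefficients of \<open>G\<close> (\<open>binomial_times_kummer_recurrence\<close>). For \<open>a = 1/2\<close>, \<open>c = 3/2\<close> this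
  is the recurrence with \<open>\<beta>\<^sub>0\<close>, \<open>\<beta>\<^sub>1\<close>, \<open>\<beta>\<^sub>2\<close>, and the three initial values agree as well, so \<open>u\<^sub>n\<close> is the
  \<open>n\<close>-th coefficient of \<open>B M\<close> (\<open>u_coeff_eq_fps_nth\<close>).

  The passage from formal to convergent series is a Cauchy product: the binomial series converges
  absolutely for \<open>|\<theta> w| < 1\<close> and Kummer's series converges absolutely everywhere. On that disc
  \<open>1 - \<theta> w\<close> has positive real part, so the binomial series sums to the principal branch.
\<close>

section \<open>The two factors as formal power series\<close>

definition kummer_fps :: "complex \<Rightarrow> complex \<Rightarrow> complex fps" where
  "kummer_fps a c = Abs_fps (\<lambda>n. pochhammer a n / pochhammer c n / fact n)"

definition binomial_fps :: "complex \<Rightarrow> complex \<Rightarrow> complex fps" where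
  "binomial_fps \<theta> p = Abs_fps (\<lambda>n. (p gchoose n) * (- \<theta>) ^ n)"

lemma kummer_fps_ode:
  assumes "\<And>n. c + of_nat n \<noteq> 0"
  shows "fps_X * fps_deriv (fps_deriv (kummer_fps a c))
           + (fps_const c - fps_X) * fps_deriv (kummer_fps a c)
           - fps_const a * kummer_fps a c = 0"
proof (rule fps_ext)
  fix n
  have nz: "pochhammer c k \<noteq> 0" for k
    using assms by (auto simp: pochhammer_eq_0_iff add_eq_0_iff2)
  have step: "of_nat (Suc n) * (c + of_nat n) * fps_nth (kummer_fps a c) (Suc n)
          = (a + of_nat n) * fps_nth (kummer_fps a c) n"
    using nz[of n] assms[of n]
    by (simp add: kummer_fps_def pochhammer_Suc divide_simps del: of_nat_Suc)
  show "fps_nth (fps_X * fps_deriv (fps_deriv (kummer_fps a c))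
           + (fps_const c - fps_X) * fps_deriv (kummer_fps a c)
           - fps_const a * kummer_fps a c) n = fps_nth 0 n"
    using step by (cases n) (simp_all add: algebra_simps)
qed

lemma binomial_fps_ode:
  "(1 - fps_const \<theta> * fps_X) * fps_deriv (binomial_fps \<theta> p)
     = - fps_const (p * \<theta>) * binomial_fps \<theta> p"
proof (rule fps_ext)
  fix n
  have "of_nat (Suc n) * (p gchoose Suc n) = (p - of_nat n) * (p gchoose n)"
    using gbinomial_absorb_comp[of p n] gbinomial_absorption[of n p] by simp
  hence step: "of_nat (Suc n) * fps_nth (binomial_fps \<theta> p) (Suc n)
       = - \<theta> * (p - of_nat n) * fps_nth (binomial_fps \<theta> p) n"
    unfolding binomial_fps_def by (simp del: of_nat_Suc add: mult_ac)
  show "fps_nth ((1 - fps_const \<theta> * fps_X) * fps_deriv (binomial_fps \<theta> p)) n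
     = fps_nth (- fps_const (p * \<theta>) * binomial_fps \<theta> p) n"
    using step by (cases n) (simp_all add: algebra_simps)
qed

section \<open>The differential equation and the recurrence of the product\<close>

text \<open>
  With \<open>s = 1 - \<theta> X\<close>, the equation for \<open>B\<close> makes \<open>s G' + p \<theta> G = s B M'\<close>. Differentiating this
  and multiplying by \<open>s\<close> gives \<open>s\<^sup>2 G'' + 2 p \<theta> s G' + p (p + 1) \<theta>\<^sup>2 G = s\<^sup>2 B M''\<close>. The three
  summands below are thus \<open>X s\<^sup>2 B M''\<close>, \<open>(c - X) s\<^sup>2 B M'\<close> and \<open>- a s\<^sup>2 B M\<close>, which add up to \<open>s\<^sup>2 B\<close>
  times the left-hand side of Kummer's equation.
\<close>
lemma binomial_times_kummer_ode:
  fixes \<theta> p a c :: complex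
  assumes "\<And>n. c + of_nat n \<noteq> 0"
  defines "G \<equiv> binomial_fps \<theta> p * kummer_fps a c"
    and "s \<equiv> 1 - fps_const \<theta> * fps_X"
  shows "fps_X * (s\<^sup>2 * fps_deriv (fps_deriv G) + fps_const (2 * p * \<theta>) * s * fps_deriv G
                  + fps_const (p * (p + 1) * \<theta>\<^sup>2) * G)
           + (fps_const c - fps_X) * (s\<^sup>2 * fps_deriv G + fps_const (p * \<theta>) * s * G)
           - fps_const a * s\<^sup>2 * G = 0"
proof -
  define B where "B = binomial_fps \<theta> p"
  define M where "M = kummer_fps a c"
  define t where "t = fps_const \<theta>"
  define q where "q = fps_const p"
  have const_eqs: "fps_const (p * \<theta>) = q * t" "fps_const (2 * p * \<theta>) = 2 * q * t"
      "fps_const (p * (p + 1) * \<theta>\<^sup>2) = q * (q + 1) * t\<^sup>2"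
    by (simp_all add: t_def q_def power2_eq_square mult_ac
        flip: fps_const_mult fps_const_add numeral_fps_const)
  have G: "G = B * M" by (simp add: G_def B_def M_def)
  have s': "fps_deriv s = - t" by (simp add: s_def t_def)
  have t': "fps_deriv t = 0" "fps_deriv q = 0" by (simp_all add: t_def q_def)
  have B': "s * fps_deriv B = - (q * t * B)"
    using binomial_fps_ode[of \<theta> p] by (simp add: s_def B_def const_eqs)
  have 1: "s * fps_deriv G + q * t * G = s * B * fps_deriv M"
    using B' unfolding G by simp algebra
  have "fps_deriv (s * fps_deriv G + q * t * G) = fps_deriv (s * B * fps_deriv M)"
    by (simp only: 1)
  hence "s * fps_deriv (fps_deriv G) - t * fps_deriv G + q * t * fps_deriv G
      = s * B * fps_deriv (fps_deriv M) + (s * fps_deriv B - t * B) * fps_deriv M"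
    by (simp add: s' t' algebra_simps)
  hence 2: "s\<^sup>2 * fps_deriv (fps_deriv G) + 2 * q * t * s * fps_deriv G + q * (q + 1) * t\<^sup>2 * G
      = s\<^sup>2 * B * fps_deriv (fps_deriv M)"
    using 1 B' by algebra
  have 3: "fps_X * fps_deriv (fps_deriv M) + (fps_const c - fps_X) * fps_deriv M
              - fps_const a * M = 0"
    unfolding M_def by (rule kummer_fps_ode[OF assms(1)])
  have "s\<^sup>2 * fps_deriv G + q * t * s * G = s\<^sup>2 * B * fps_deriv M"
    using 1 by algebra
  thus ?thesis
    unfolding const_eqs 2 using 3 G by algebra
qed

text \<open>
  This is the coefficient of \<open>X\<^bsup>m+2\<^esup>\<close> in the differential equation. The leading terms
  \<open>X G''\<close> and \<open>c G'\<close> contribute \<open>u (m + 3)\<close> there, while the terms of lowest reach,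
  \<open>X\<^sup>3 G'\<close> and \<open>X\<^sup>2 G\<close>, contribute \<open>u m\<close>.
\<close>
lemma binomial_times_kummer_recurrence:
  fixes \<theta> p a c :: complex and m :: nat
  assumes "\<And>n. c + of_nat n \<noteq> 0"
  defines "u \<equiv> fps_nth (binomial_fps \<theta> p * kummer_fps a c)"
    and "n \<equiv> of_nat (m + 2) :: complex"
  shows "(n + 1) * (n + c) * u (m + 3)
    = (n + a + \<theta> * (2 * n * (n - 1 + c) - p * (2 * n + c))) * u (m + 2)
      - \<theta> * (2 * (n - 1) - p + 2 * a + \<theta> * (n - 1 - p) * (n - 2 - p + c)) * u (m + 1)
      + \<theta>\<^sup>2 * (n - 2 - p + a) * u m"
proof -
  define G where "G = binomial_fps \<theta> p * kummer_fps a c"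
  define s :: "complex fps" where "s = 1 - fps_const \<theta> * fps_X"
  let ?F = "fps_X * (s\<^sup>2 * fps_deriv (fps_deriv G) + fps_const (2 * p * \<theta>) * s * fps_deriv G
                  + fps_const (p * (p + 1) * \<theta>\<^sup>2) * G)
           + (fps_const c - fps_X) * (s\<^sup>2 * fps_deriv G + fps_const (p * \<theta>) * s * G)
           - fps_const a * s\<^sup>2 * G"
  have s1: "fps_nth (s * f) (Suc k) = fps_nth f (Suc k) - \<theta> * fps_nth f k" for f k
    by (simp add: s_def algebra_simps)
  have s0: "fps_nth (s * f) 0 = fps_nth f 0" for f
    by (simp add: s_def)
  have "fps_nth ?F (m + 2) = 0"
    using binomial_times_kummer_ode[OF assms(1), of \<theta> p a] unfolding G_def s_def by simp
  moreover have "?F = fps_X * (s * (s * fps_deriv (fps_deriv G)))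
       + fps_const (2 * p * \<theta>) * (fps_X * (s * fps_deriv G))
       + fps_const (p * (p + 1) * \<theta>\<^sup>2) * (fps_X * G)
       + fps_const c * (s * (s * fps_deriv G)) - fps_X * (s * (s * fps_deriv G))
       + fps_const (c * p * \<theta>) * (s * G) - fps_const (p * \<theta>) * (fps_X * (s * G))
       - fps_const a * (s * (s * G))"
    by (simp add: algebra_simps power2_eq_square flip: fps_const_mult)
  ultimately have E: "fps_nth (fps_X * (s * (s * fps_deriv (fps_deriv G)))
       + fps_const (2 * p * \<theta>) * (fps_X * (s * fps_deriv G))
       + fps_const (p * (p + 1) * \<theta>\<^sup>2) * (fps_X * G)
       + fps_const c * (s * (s * fps_deriv G)) - fps_X * (s * (s * fps_deriv G))
       + fps_const (c * p * \<theta>) * (s * G) - fps_const (p * \<theta>) * (fps_X * (s * G))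
       - fps_const a * (s * (s * G))) (Suc (Suc m)) = 0"
    by simp
  define x g0 g1 g2 g3 where "x = (of_nat m :: complex)" and "g0 = fps_nth G m"
    and "g1 = fps_nth G (Suc m)" and "g2 = fps_nth G (Suc (Suc m))"
    and "g3 = fps_nth G (Suc (Suc (Suc m)))"
  note atoms = x_def g0_def g1_def g2_def g3_def
  have ss: "fps_nth (s * (s * f)) (Suc (Suc k))
      = fps_nth f (Suc (Suc k)) - 2 * \<theta> * fps_nth f (Suc k) + \<theta>\<^sup>2 * fps_nth f k" for f k
    by (simp only: s1) (simp add: algebra_simps power2_eq_square)
  \<comment> \<open>For a derivative the lowest term is \<open>k f\<^sub>k\<close>, which vanishes at \<open>k = 0\<close>; so the formula
      for the twofold product with \<open>s\<close> already holds one index earlier.\<close>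
  have ss': "fps_nth (s * (s * fps_deriv f)) (Suc k) = fps_nth (fps_deriv f) (Suc k)
      - 2 * \<theta> * fps_nth (fps_deriv f) k + \<theta>\<^sup>2 * (of_nat k * fps_nth f k)" for f k
  proof (cases k)
    case 0
    show ?thesis
      unfolding 0 s1 s0 by simp
  qed (simp add: ss del: of_nat_Suc)
  have coeffs: "fps_nth (s * (s * fps_deriv (fps_deriv G))) (Suc m)
      = (x + 2) * (x + 3) * g3 - 2 * \<theta> * ((x + 1) * (x + 2) * g2) + \<theta>\<^sup>2 * (x * ((x + 1) * g1))"
    "fps_nth (s * fps_deriv G) (Suc m) = (x + 2) * g2 - \<theta> * ((x + 1) * g1)"
    "fps_nth (s * (s * fps_deriv G)) (Suc (Suc m))
      = (x + 3) * g3 - 2 * \<theta> * ((x + 2) * g2) + \<theta>\<^sup>2 * ((x + 1) * g1)"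
    "fps_nth (s * (s * fps_deriv G)) (Suc m) = (x + 2) * g2 - 2 * \<theta> * ((x + 1) * g1) + \<theta>\<^sup>2 * (x * g0)"
    "fps_nth (s * G) (Suc (Suc m)) = g2 - \<theta> * g1"
    "fps_nth (s * G) (Suc m) = g1 - \<theta> * g0"
    "fps_nth (s * (s * G)) (Suc (Suc m)) = g2 - 2 * \<theta> * g1 + \<theta>\<^sup>2 * g0"
    unfolding atoms unfolding ss ss' unfolding s1
    by (simp_all add: add_ac mult_ac)
  have X: "fps_nth (fps_X * f) (Suc k) = fps_nth f k" for f :: "complex fps" and k
    by simp
  have rec: "(x + 2) * (x + 3) * g3 - 2 * \<theta> * ((x + 1) * (x + 2) * g2) + \<theta>\<^sup>2 * (x * ((x + 1) * g1))
      + 2 * p * \<theta> * ((x + 2) * g2 - \<theta> * ((x + 1) * g1)) + p * (p + 1) * \<theta>\<^sup>2 * g1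
      + c * ((x + 3) * g3 - 2 * \<theta> * ((x + 2) * g2) + \<theta>\<^sup>2 * ((x + 1) * g1))
      - ((x + 2) * g2 - 2 * \<theta> * ((x + 1) * g1) + \<theta>\<^sup>2 * (x * g0))
      + c * p * \<theta> * (g2 - \<theta> * g1) - p * \<theta> * (g1 - \<theta> * g0)
      - a * (g2 - 2 * \<theta> * g1 + \<theta>\<^sup>2 * g0) = 0"
    using E unfolding fps_add_nth fps_sub_nth fps_mult_left_const_nth X coeffs g1_def[symmetric] .
  have "n = x + 2" "u (m + 3) = g3" "u (m + 2) = g2" "u (m + 1) = g1" "u m = g0"
    by (simp_all add: atoms u_def n_def G_def numeral_3_eq_3)
  moreover from rec have "((x + 2) + 1) * ((x + 2) + c) * g3
    = ((x + 2) + a + \<theta> * (2 * (x + 2) * ((x + 2) - 1 + c) - p * (2 * (x + 2) + c))) * g2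
      - \<theta> * (2 * ((x + 2) - 1) - p + 2 * a + \<theta> * ((x + 2) - 1 - p) * ((x + 2) - 2 - p + c)) * g1
      + \<theta>\<^sup>2 * ((x + 2) - 2 - p + a) * g0"
    by (simp add: algebra_simps power2_eq_square)
  ultimately show ?thesis by simp
qed

section \<open>The coefficients for the error function\<close>

lemma pochhammer_three_halves:
  "pochhammer (3/2) n = (2 * of_nat n + 1) * pochhammer (1/2 :: 'a :: field_char_0) n"
proof (induction n)
  case (Suc n)
  then show ?case by (simp add: pochhammer_Suc field_simps)
qed simp

lemma kummer_fps_half_nth: "fps_nth (kummer_fps (1/2) (3/2)) n = 1 / ((2 * of_nat n + 1) * fact n)"
proof -
  have "(1/2 :: complex) + of_nat k \<noteq> 0" for k
    by (auto simp: complex_eq_iff)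
  hence "pochhammer (1/2 :: complex) n \<noteq> 0"
    by (auto simp: pochhammer_eq_0_iff add_eq_0_iff2)
  thus ?thesis
    by (simp add: kummer_fps_def pochhammer_three_halves)
qed

lemma u_coeff_eq_fps_nth:
  "u_coeff \<theta> p n = fps_nth (binomial_fps \<theta> p * kummer_fps (1/2) (3/2)) n"
proof (induction \<theta> p n rule: u_coeff.induct)
  case (2 \<theta> p)
  show ?case
    by (simp add: fps_mult_nth kummer_fps_half_nth binomial_fps_def)
next
  case (3 \<theta> p)
  have "p gchoose Suc (Suc 0) = p * p / 2 - p / 2"
    by (simp add: gbinomial_prod_rev algebra_simps diff_divide_distrib)
  thus ?case
    by (simp add: fps_mult_nth kummer_fps_half_nth binomial_fps_def)
      (simp add: algebra_simps power2_eq_square)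
next
  case (4 \<theta> p m)
  let ?u = "fps_nth (binomial_fps \<theta> p * kummer_fps (1/2) (3/2))"
  define n where "n = (of_nat (m + 2) :: complex)"
  \<comment> \<open>Half the common denominator \<open>(n + 1) (3 + 2 n)\<close>, which is the leading coefficient
      \<open>(n + 1) (n + c)\<close> of the recurrence at \<open>c = 3/2\<close>.\<close>
  define N where "N = (n + 1) * (n + 3/2)"
  have n: "n + 1 \<noteq> 0" "n + 3/2 \<noteq> 0" "3 + 2 * n \<noteq> 0"
    by (auto simp: n_def complex_eq_iff)
  have c: "3/2 + of_nat k \<noteq> (0 :: complex)" for k
    by (auto simp: complex_eq_iff)
  have rec: "N * ?u (m + 3)
    = (n + 1/2 + \<theta> * (2 * n * (n - 1 + 3/2) - p * (2 * n + 3/2))) * ?u (m + 2)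
      - \<theta> * (2 * (n - 1) - p + 2 * (1/2) + \<theta> * (n - 1 - p) * (n - 2 - p + 3/2)) * ?u (m + 1)
      + \<theta>\<^sup>2 * (n - 2 - p + 1/2) * ?u m"
    using binomial_times_kummer_recurrence[OF c, where a = "1/2"] by (simp only: N_def n_def)
  have beta0: "N * beta0 \<theta> p (m + 2)
      = n + 1/2 + \<theta> * (2 * n * (n - 1 + 3/2) - p * (2 * n + 3/2))"
    unfolding beta0_def Let_def n_def[symmetric] N_def using n by (simp add: divide_simps) algebra
  have beta1: "N * beta1 \<theta> p (m + 2)
      = - \<theta> * (2 * (n - 1) - p + 2 * (1/2) + \<theta> * (n - 1 - p) * (n - 2 - p + 3/2))"
    unfolding beta1_def Let_def n_def[symmetric] N_def using n by (simp add: divide_simps) algebra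
  have beta2: "N * beta2 \<theta> p (m + 2) = \<theta>\<^sup>2 * (n - 2 - p + 1/2)"
    unfolding beta2_def Let_def n_def[symmetric] N_def using n by (simp add: divide_simps) algebra
  have "N * ?u (m + 3) = N *
      (beta0 \<theta> p (m + 2) * ?u (m + 2) + beta1 \<theta> p (m + 2) * ?u (m + 1) + beta2 \<theta> p (m + 2) * ?u m)"
    unfolding rec distrib_left[of N] mult.assoc[of N, symmetric] beta0 beta1 beta2
    by (simp only: mult_minus_left diff_conv_add_uminus)
  hence "?u (m + 3) =
      beta0 \<theta> p (m + 2) * ?u (m + 2) + beta1 \<theta> p (m + 2) * ?u (m + 1) + beta2 \<theta> p (m + 2) * ?u m"
    using n by (simp add: N_def)
  thus ?case
    using 4 by (simp add: numeral_3_eq_3)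
qed (simp add: kummer_fps_half_nth binomial_fps_def)

section \<open>Convergence\<close>

lemma binomial_fps_sums:
  assumes "norm (\<theta> * w) < 1"
  shows "(\<lambda>n. fps_nth (binomial_fps \<theta> p) n * w ^ n) sums (1 - \<theta> * w) powr p"
    and "summable (\<lambda>n. norm (fps_nth (binomial_fps \<theta> p) n * w ^ n))"
proof -
  have eq: "fps_nth (binomial_fps \<theta> p) n * w ^ n = (p gchoose n) * (- (\<theta> * w)) ^ n" for n
    by (simp add: binomial_fps_def flip: power_mult_distrib)
  show "(\<lambda>n. fps_nth (binomial_fps \<theta> p) n * w ^ n) sums (1 - \<theta> * w) powr p"
    using gen_binomial_complex[of "- (\<theta> * w)" p] assms by (simp add: eq)
  \<comment> \<open>Convergence at some \<open>r\<close> strictly between \<open>|\<theta> w|\<close> and 1 forces absolute convergence at \<open>\<theta> w\<close>.\<close>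
  obtain r where r: "norm (\<theta> * w) < r" "r < 1"
    using assms dense by blast
  have "norm (complex_of_real r) = r"
    using norm_ge_zero[of "\<theta> * w"] r by (simp del: norm_ge_zero)
  hence "summable (\<lambda>n. (p gchoose n) * complex_of_real r ^ n)"
    using gen_binomial_complex[of "of_real r" p] r by (auto simp: sums_iff)
  from powser_insidea[OF this, of "- (\<theta> * w)"]
  show "summable (\<lambda>n. norm (fps_nth (binomial_fps \<theta> p) n * w ^ n))"
    using r \<open>norm (complex_of_real r) = r\<close> by (simp add: eq)
qed

text \<open>The coefficients \<open>1 / ((2 n + 1) n!)\<close> are dominated by those of the exponential series.\<close>
lemma kummer_fps_half_summable:
  "summable (\<lambda>n. norm (fps_nth (kummer_fps (1/2) (3/2)) n * w ^ n))"
proof (rule summable_comparison_test')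
  show "summable (\<lambda>n. norm w ^ n /\<^sub>R fact n)"
    by (rule summable_exp_generic)
  fix n :: nat
  have "norm (2 * of_nat n + 1 :: complex) = norm (of_nat (2 * n + 1) :: complex)"
    by (simp add: add.commute)
  also have "\<dots> = 2 * real n + 1"
    unfolding norm_of_nat by simp
  finally have "norm (fps_nth (kummer_fps (1/2) (3/2)) n * w ^ n)
      = norm w ^ n / ((2 * real n + 1) * fact n)"
    by (simp add: kummer_fps_half_nth norm_mult norm_divide norm_power)
  also have "\<dots> \<le> norm w ^ n / fact n"
    by (intro divide_left_mono) (auto simp: mult_le_cancel_right1)
  finally show "norm (norm (fps_nth (kummer_fps (1/2) (3/2)) n * w ^ n)) \<le> norm w ^ n /\<^sub>R fact n"
    by (simp add: field_simps)
qed

lemma powr_times_kummer_M_sums: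
  assumes "norm (\<theta> * w) < 1"
  shows "(\<lambda>n. u_coeff \<theta> p n * w ^ n) sums ((1 - \<theta> * w) powr p * kummer_M (1/2) (3/2) w)"
proof -
  let ?B = "fps_nth (binomial_fps \<theta> p)" and ?M = "fps_nth (kummer_fps (1/2) (3/2))"
  have "(\<lambda>n. \<Sum>i\<le>n. ?B i * w ^ i * (?M (n - i) * w ^ (n - i)))
      sums ((\<Sum>n. ?B n * w ^ n) * (\<Sum>n. ?M n * w ^ n))"
    by (rule Cauchy_product_sums[OF binomial_fps_sums(2)[OF assms] kummer_fps_half_summable])
  moreover have "(\<Sum>n. ?B n * w ^ n) = (1 - \<theta> * w) powr p"
    using binomial_fps_sums(1)[OF assms] by (rule sums_unique[symmetric])
  moreover have "(\<Sum>n. ?M n * w ^ n) = kummer_M (1/2) (3/2) w"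
    by (simp add: kummer_fps_def kummer_M_def)
  moreover have "(\<Sum>i\<le>n. ?B i * w ^ i * (?M (n - i) * w ^ (n - i))) = u_coeff \<theta> p n * w ^ n" for n
  proof -
    have "(\<Sum>i\<le>n. ?B i * w ^ i * (?M (n - i) * w ^ (n - i)))
        = (\<Sum>i\<le>n. ?B i * ?M (n - i) * w ^ n)"
      by (intro sum.cong refl) (simp add: mult_ac flip: power_add)
    thus ?thesis
      by (simp add: u_coeff_eq_fps_nth fps_mult_nth sum_distrib_right atLeast0AtMost)
  qed
  ultimately show ?thesis by simp
qed

theorem corollary4p1:
  fixes p \<theta> z :: complex
  assumes "\<theta> = 0 \<or> (norm z) ^ 2 < 1 / norm \<theta>"
    and "Arg (1 + \<theta> * z ^ 2) \<in> {- pi <..< pi}"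
  shows "(\<lambda>n. a_coeff \<theta> p n * z ^ (2 * n + 1)) sums ((1 + \<theta> * z ^ 2) powr p * Erf z)"
proof -
  have "norm (\<theta> * - (z\<^sup>2)) < 1"
    using assms(1) by (cases "\<theta> = 0") (auto simp: norm_mult norm_power field_simps)
  from sums_mult[OF powr_times_kummer_M_sums[OF this, of p], of "z / of_real (sqrt pi)"]
  have "(\<lambda>n. z / of_real (sqrt pi) * (u_coeff \<theta> p n * (- (z\<^sup>2)) ^ n))
      sums ((1 + \<theta> * z\<^sup>2) powr p * Erf z)"
    by (simp add: Erf_def mult_ac)
  moreover have "z / of_real (sqrt pi) * (u_coeff \<theta> p n * (- (z\<^sup>2)) ^ n)
      = a_coeff \<theta> p n * z ^ (2 * n + 1)" for n
    by (simp add: a_coeff_def power_minus[of "z\<^sup>2"] power_mult)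
  ultimately show ?thesis by simp
qed

end
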